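(* $N^*(3,2)=4$; that is, the smallest size of a uniform determinantal representation of the generic polynomial of degree $2$ in $3$ variables is $4$.
   Context: Let $K$ be a field. For $n,d\in\mathbb{Z}_{\ge 0}$ the generic polynomial of degree $d$ in $n$ variables is $p_{n,d}=\sum_{|\alpha|\le d} c_\alpha x^\alpha$, where $x=(x_1,\ldots,x_n)$, $\alpha\in\mathbb{Z}_{\ge 0}^n$, $|\alpha|=\sum_i\alpha_i$, and each $c_\alpha$ is regarded as a variable. A uniform determinantal representation of $p_{n,d}$ of size $N$ is an $N\times N$ matrix $M$ whose entries are $K$-linear combinations of the monomials $1,x_i,c_\alpha,c_\alpha x_i$ ($1\le i\le n$, $|\alpha|\le d$), such that $\det(M)=p_{n,d}$. $N^*(n,d)$ denotes the minimum of all sizes of uniform determinantal representations of $p_{n,d}$. *)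

theory Defs
  imports "HOL-Library.Poly_Mapping" "Jordan_Normal_Form.Determinant"
begin

text \<open>The indeterminates: \<open>X i\<close> is $x_i$, and \<open>C \<alpha>\<close> is the coefficient variable $c_\alpha$.\<close>

datatype indet = X nat | C "nat \<Rightarrow>\<^sub>0 nat"

text \<open>Polynomials over \<open>'k\<close> in all these indeterminates: finitely supported maps from monomials
  (finitely supported exponent functions) to coefficients. The ring product is convolution.\<close>

type_synonym 'k mpoly = "(indet \<Rightarrow>\<^sub>0 nat) \<Rightarrow>\<^sub>0 'k"

definition Var :: "indet \<Rightarrow> 'k::field mpoly" where
  "Var v = Poly_Mapping.single (Poly_Mapping.single v 1) 1"

definition mscale :: "'k::field \<Rightarrow> 'k mpoly \<Rightarrow> 'k mpoly" where
  "mscale a p = Poly_Mapping.single 0 a * p"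

lemma vector_space_mscale: "vector_space mscale"
  by unfold_locales
    (simp_all add: mscale_def algebra_simps single_add mult_single flip: mult.assoc)

definition exponents :: "nat \<Rightarrow> nat \<Rightarrow> (nat \<Rightarrow>\<^sub>0 nat) set" where
  "exponents n d = {\<alpha>. Poly_Mapping.keys \<alpha> \<subseteq> {1..n} \<and> (\<Sum>i=1..n. Poly_Mapping.lookup \<alpha> i) \<le> d}"

lemma finite_exponents: "finite (exponents n d)"
proof (rule finite_imageD)
  show "inj_on Poly_Mapping.lookup (exponents n d)"
    by (auto intro: inj_onI poly_mapping_eqI)
  have "Poly_Mapping.lookup ` exponents n d \<subseteq> {f. \<forall>i. (i \<in> {1..n} \<longrightarrow> f i \<in> {..d}) \<and> (i \<notin> {1..n} \<longrightarrow> f i = 0)}"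
  proof (clarify, intro conjI impI)
    fix \<alpha> i assume \<alpha>: "\<alpha> \<in> exponents n d"
    { assume "i \<in> {1..n}"
      then have "Poly_Mapping.lookup \<alpha> i \<le> (\<Sum>j=1..n. Poly_Mapping.lookup \<alpha> j)"
        by (intro member_le_sum) auto
      with \<alpha> show "Poly_Mapping.lookup \<alpha> i \<in> {..d}" by (simp add: exponents_def) }
    { assume "i \<notin> {1..n}"
      with \<alpha> show "Poly_Mapping.lookup \<alpha> i = 0" by (auto simp: exponents_def in_keys_iff) }
  qed
  then show "finite (Poly_Mapping.lookup ` exponents n d)"
    by (rule finite_subset) (intro finite_set_of_finite_funs finite_atLeastAtMost finite_atMost)
qed

definition generic_poly :: "nat \<Rightarrow> nat \<Rightarrow> 'k::field mpoly" where
  "generic_poly n d =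
     (\<Sum>\<alpha>\<in>exponents n d. Var (C \<alpha>) * (\<Prod>i=1..n. Var (X i) ^ Poly_Mapping.lookup \<alpha> i))"

definition entry_monomials :: "nat \<Rightarrow> nat \<Rightarrow> 'k::field mpoly set" where
  "entry_monomials n d =
     {1} \<union> {Var (X i) | i. i \<in> {1..n}}
         \<union> {Var (C \<alpha>) | \<alpha>. \<alpha> \<in> exponents n d}
         \<union> {Var (C \<alpha>) * Var (X i) | \<alpha> i. \<alpha> \<in> exponents n d \<and> i \<in> {1..n}}"

definition uniform_det_rep :: "nat \<Rightarrow> nat \<Rightarrow> nat \<Rightarrow> 'k::field mpoly mat \<Rightarrow> bool" where
  "uniform_det_rep n d N M \<longleftrightarrow>
     M \<in> carrier_mat N N \<and>
     (\<forall>i<N. \<forall>j<N. M $$ (i, j) \<in> module.span mscale (entry_monomials n d)) \<and>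
     det M = generic_poly n d"

text \<open>The minimal size. It depends on the field \<open>'k\<close>, hence the type argument. As usual for
  \<open>Least\<close>, the value is meaningful only if some representation exists.\<close>

definition Nstar :: "'k::field itself \<Rightarrow> nat \<Rightarrow> nat \<Rightarrow> nat" where
  "Nstar _ n d = (LEAST N. \<exists>M :: 'k mpoly mat. uniform_det_rep n d N M)"

end

theory Submission
  imports Defs
begin

text \<open>
  Upper bound. The \<open>4 \<times> 4\<close> matrix with first row \<open>r\<^sub>0, r\<^sub>1, r\<^sub>2, r\<^sub>3\<close> and, below it, the column
  \<open>-x\<^sub>1, -x\<^sub>2, -x\<^sub>3\<close> next to an identity block, has determinant
  \<open>r\<^sub>0 + r\<^sub>1 x\<^sub>1 + r\<^sub>2 x\<^sub>2 + r\<^sub>3 x\<^sub>3\<close> (\<open>det_bordered_identity\<close>). Every monomial of degree at most 2 is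
  either 1 or some \<open>x\<^sub>j\<close> times a monomial of degree at most 1, so the \<open>r\<^sub>j\<close> can be chosen
  as combinations of the \<open>c\<^sub>\<alpha>\<close> and \<open>c\<^sub>\<alpha> x\<^sub>i\<close> making this the generic quadric.

  Lower bound. A representation of smaller size can be padded by an identity block, so it suffices
  to exclude size 3. Let \<open>A\<close> be the part of \<open>M\<close> free of the \<open>c\<^sub>\<alpha>\<close>. Comparing terms of order 0 and 1
  in the \<open>c\<^sub>\<alpha>\<close> gives \<open>det A = 0\<close> and \<open>tr (adj A \<sqdot> M\<^sub>\<alpha>) = x\<^sup>\<alpha>\<close>, where \<open>M\<^sub>\<alpha>\<close>, the coefficient of \<open>c\<^sub>\<alpha>\<close>
  in \<open>M\<close>, has entries of degree at most 1 in \<open>x\<close>. The constant part of \<open>A\<close> is singular, so after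
  multiplying by invertible scalar matrices its first row and column vanish
  (\<open>singular_mat_clear_first_row_column\<close>), and the identities still hold up to a nonzero scalar
  factor; by the trace identity for \<open>\<alpha> = 0\<close> the remaining
  \<open>2 \<times> 2\<close> block \<open>B\<close> is invertible. The terms of \<open>det A = 0\<close> of degree 1 and 2 now say that the
  entry of \<open>A\<close> in the corner is 0 and that \<open>w\<^sup>T adj(B) u = 0\<close>, where the linear forms \<open>w\<close> and \<open>u\<close> are
  the rest of the first row and column of \<open>A\<close>. A totally
  singular subspace for a hyperbolic quadratic form in four variables has dimension at most 2, so
  the entries of \<open>w\<close> and \<open>adj(B) u\<close>, four linear forms in three variables, vanish together at some
  \<open>v \<noteq> 0\<close>, and there \<open>u\<close> vanishes too
  (\<open>hyperbolic_lin_forms_common_zero\<close>). On the line \<open>x = t v\<close> the adjugate of \<open>A\<close> thus has a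
  single nonzero entry \<open>m(t)\<close>, and the trace identity says that \<open>m(t)\<close> times a polynomial of degree
  at most 1 is a nonzero scalar times \<open>(t v)\<^sup>\<alpha>\<close>. For \<open>\<alpha> = 0\<close> this makes \<open>m\<close> constant, and then the case \<open>\<alpha> = 2 e\<^sub>i\<close> with
  \<open>v\<^sub>i \<noteq> 0\<close> is impossible for reasons of degree (\<open>no_scaled_rep_size_3\<close>).
\<close>

section \<open>Evaluation of polynomials\<close>

text \<open>The value of a polynomial when coefficients are mapped by \<open>h\<close> and the
  indeterminates are replaced by \<open>f\<close>.\<close>

definition eval_mpoly :: "('k::field \<Rightarrow> 'r::comm_ring_1) \<Rightarrow> (indet \<Rightarrow> 'r) \<Rightarrow> 'k mpoly \<Rightarrow> 'r" where
  "eval_mpoly h f p =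
     (\<Sum>m\<in>Poly_Mapping.keys p. h (Poly_Mapping.lookup p m) *
        (\<Prod>v\<in>Poly_Mapping.keys m. f v ^ Poly_Mapping.lookup m v))"

lemma eval_monomial_add:
  fixes f :: "indet \<Rightarrow> 'r::comm_ring_1" and m n :: "indet \<Rightarrow>\<^sub>0 nat"
  shows "(\<Prod>v\<in>Poly_Mapping.keys (m + n). f v ^ Poly_Mapping.lookup (m + n) v) =
    (\<Prod>v\<in>Poly_Mapping.keys m. f v ^ Poly_Mapping.lookup m v) *
    (\<Prod>v\<in>Poly_Mapping.keys n. f v ^ Poly_Mapping.lookup n v)"
proof -
  let ?S = "Poly_Mapping.keys m \<union> Poly_Mapping.keys n"
  have ext: "(\<Prod>v\<in>Poly_Mapping.keys k. f v ^ Poly_Mapping.lookup k v) =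
      (\<Prod>v\<in>?S. f v ^ Poly_Mapping.lookup k v)"
    if "Poly_Mapping.keys k \<subseteq> ?S" for k
    using that by (intro prod.mono_neutral_left) (auto simp: in_keys_iff)
  show ?thesis
    unfolding ext[OF keys_add] ext[OF Un_upper1] ext[OF Un_upper2]
    by (simp add: lookup_add power_add prod.distrib)
qed

lemma poly_mapping_sum_single:
  "(\<Sum>m\<in>Poly_Mapping.keys p. Poly_Mapping.single m (Poly_Mapping.lookup p m)) = p"
  by (rule poly_mapping_eqI) (auto simp: lookup_sum lookup_single when_def in_keys_iff)

locale field_to_ring_hom = comm_ring_hom hom for hom :: "'k::field \<Rightarrow> 'r::comm_ring_1"
begin

lemma eval_mpoly_add: "eval_mpoly hom f (p + q) = eval_mpoly hom f p + eval_mpoly hom f q"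
  unfolding eval_mpoly_def
  by (rule setsum_keys_plus_distrib) (simp_all add: hom_distribs algebra_simps)

lemma eval_mpoly_sum: "eval_mpoly hom f (\<Sum>i\<in>A. g i) = (\<Sum>i\<in>A. eval_mpoly hom f (g i))"
proof -
  have "eval_mpoly hom f 0 = 0" by (simp add: eval_mpoly_def)
  then show ?thesis
    by (induction A rule: infinite_finite_induct) (simp_all add: eval_mpoly_add)
qed

lemma eval_mpoly_single:
  "eval_mpoly hom f (Poly_Mapping.single m a) =
     hom a * (\<Prod>v\<in>Poly_Mapping.keys m. f v ^ Poly_Mapping.lookup m v)"
  by (simp add: eval_mpoly_def)

lemma eval_mpoly_mult: "eval_mpoly hom f (p * q) = eval_mpoly hom f p * eval_mpoly hom f q"
proof -
  let ?s = "\<lambda>p m. Poly_Mapping.single m (Poly_Mapping.lookup p m)"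
  have "p * q = (\<Sum>m\<in>Poly_Mapping.keys p. \<Sum>n\<in>Poly_Mapping.keys q. ?s p m * ?s q n)"
    by (simp only: sum_product[symmetric] poly_mapping_sum_single)
  also have "eval_mpoly hom f \<dots> =
      (\<Sum>m\<in>Poly_Mapping.keys p. \<Sum>n\<in>Poly_Mapping.keys q.
        eval_mpoly hom f (?s p m) * eval_mpoly hom f (?s q n))"
    by (simp add: eval_mpoly_sum mult_single eval_mpoly_single eval_monomial_add hom_distribs
        mult_ac)
  also have "\<dots> = eval_mpoly hom f (\<Sum>m\<in>Poly_Mapping.keys p. ?s p m) *
      eval_mpoly hom f (\<Sum>n\<in>Poly_Mapping.keys q. ?s q n)"
    by (simp add: eval_mpoly_sum sum_product)
  finally show ?thesis by (simp only: poly_mapping_sum_single)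
qed

lemma comm_ring_hom_eval_mpoly: "comm_ring_hom (eval_mpoly hom f)"
  by unfold_locales
    (simp_all add: eval_mpoly_add eval_mpoly_mult, simp_all add: eval_mpoly_def hom_distribs)

lemma eval_mpoly_Var: "eval_mpoly hom f (Var v) = f v"
  by (simp add: Var_def eval_mpoly_single)

lemma eval_mpoly_generic_poly:
  "eval_mpoly hom f (generic_poly n d) =
     (\<Sum>\<alpha>\<in>exponents n d. f (C \<alpha>) * (\<Prod>i=1..n. f (X i) ^ Poly_Mapping.lookup \<alpha> i))"
proof -
  interpret E: comm_ring_hom "eval_mpoly hom f" by (rule comm_ring_hom_eval_mpoly)
  show ?thesis
    by (simp add: generic_poly_def eval_mpoly_Var hom_distribs E.hom_sum E.hom_prod E.hom_mult E.hom_power)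
qed

end

section \<open>Common zeros of linear forms in three variables\<close>

text \<open>The linear form on \<open>'k\<^sup>3\<close> with coefficients \<open>a\<close>. Both \<open>a\<close> and the argument \<open>v\<close> are functions on
  \<open>nat\<close> of which only the values at 1, 2, 3 matter.\<close>

definition lin_form :: "(nat \<Rightarrow> 'k::field) \<Rightarrow> (nat \<Rightarrow> 'k) \<Rightarrow> 'k" where
  "lin_form a v = (\<Sum>i=1..3. a i * v i)"

lemma lin_form_3: "lin_form a v = a 1 * v 1 + a 2 * v 2 + a 3 * v 3"
proof -
  have "{1..3::nat} = {1, 2, 3}" by auto
  then show ?thesis by (simp add: lin_form_def algebra_simps)
qed

lemma lin_form_add: "lin_form a (\<lambda>i. v i + w i) = lin_form a v + lin_form a w"
  by (simp add: lin_form_3 algebra_simps)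

lemma two_lin_forms_common_zero:
  fixes a b :: "nat \<Rightarrow> 'k::field"
  obtains v where "\<exists>i\<in>{1..3}. v i \<noteq> 0" "lin_form a v = 0" "lin_form b v = 0"
proof -
  define vec where "vec x y z = (\<lambda>i::nat. if i = 1 then x else if i = 2 then y else z)" for x y z :: 'k
  have vec: "vec x y z 1 = x" "vec x y z 2 = y" "vec x y z 3 = z" for x y z
    by (simp_all add: vec_def)
  have nz: "\<exists>i\<in>{1..3}. vec x y z i \<noteq> 0" if "x \<noteq> 0 \<or> y \<noteq> 0 \<or> z \<noteq> 0" for x y z
  proof -
    have "{1..3::nat} = {1, 2, 3}" by auto
    with that vec[of x y z] show ?thesis by auto
  qed
  note witness = that
  have goal: thesis
    if "x \<noteq> 0 \<or> y \<noteq> 0 \<or> z \<noteq> 0" "a 1 * x + a 2 * y + a 3 * z = 0" "b 1 * x + b 2 * y + b 3 * z = 0"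
    for x y z
    using that by (intro witness[of "vec x y z"] nz) (simp_all only: lin_form_3 vec)
  \<comment> \<open>The cross product is a common zero; if it is the zero vector, the forms are linearly
    dependent and any nonzero vector killed by a form spanning both will do.\<close>
  define c1 c2 c3 where c: "c1 = a 2 * b 3 - a 3 * b 2" "c2 = a 3 * b 1 - a 1 * b 3" "c3 = a 1 * b 2 - a 2 * b 1"
  show thesis
  proof (cases "c1 = 0 \<and> c2 = 0 \<and> c3 = 0")
    case False
    then show thesis
      by (intro goal[of c1 c2 c3]) (auto simp: c algebra_simps)
  next
    case True
    then have c0: "a 2 * b 3 = a 3 * b 2" "a 3 * b 1 = a 1 * b 3" "a 1 * b 2 = a 2 * b 1"
      by (auto simp: c)
    consider "a 1 \<noteq> 0 \<or> a 2 \<noteq> 0" | "a 1 = 0" "a 2 = 0" "a 3 \<noteq> 0" 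
      | "b 1 \<noteq> 0 \<or> b 2 \<noteq> 0" "a 1 = 0" "a 2 = 0" "a 3 = 0" | "b 1 = 0" "b 2 = 0" "a 1 = 0" "a 2 = 0" "a 3 = 0"
      by blast
    then show thesis
    proof cases
      case 1 then show ?thesis using c0 by (intro goal[of "- a 2" "a 1" 0]) (auto simp: algebra_simps)
    next
      case 2 then show ?thesis using c0 by (intro goal[of 0 "- a 3" "a 2"]) (auto simp: algebra_simps)
    next
      case 3 then show ?thesis by (intro goal[of "- b 2" "b 1" 0]) (auto simp: algebra_simps)
    next
      case 4 then show ?thesis by (intro goal[of 1 0 0]) auto
    qed
  qed
qed

text \<open>The case where a common zero \<open>v\<close> of \<open>f1\<close> and \<open>f2\<close> is not already a zero of \<open>g1\<close>. Polarising the
  quadratic identity at \<open>v\<close> shows that \<open>f1\<close> is a multiple of \<open>f2\<close>, after which the quadratic form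
  is a product of two linear forms, one of which must vanish identically.\<close>

lemma hyperbolic_lin_forms_common_zero_aux:
  fixes f1 f2 g1 g2 :: "nat \<Rightarrow> 'k::field"
  assumes q: "\<And>x. lin_form f1 x * lin_form g1 x + lin_form f2 x * lin_form g2 x = 0"
    and v: "lin_form f1 v = 0" "lin_form f2 v = 0" "lin_form g1 v \<noteq> 0"
  obtains w where "\<exists>i\<in>{1..3}. w i \<noteq> 0"
    "lin_form f1 w = 0" "lin_form f2 w = 0" "lin_form g1 w = 0" "lin_form g2 w = 0"
proof -
  define c where "c = - (lin_form g2 v / lin_form g1 v)"
  have f1: "lin_form f1 y = c * lin_form f2 y" for y
  proof -
    have "lin_form f1 y * lin_form g1 v + lin_form f2 y * lin_form g2 v = 0"
      using q[of "\<lambda>i. v i + y i"] q[of y] v(1,2) by (simp add: lin_form_add algebra_simps)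
    then show ?thesis using v(3) by (simp add: c_def field_simps eq_neg_iff_add_eq_0)
  qed
  define h where "h y = c * lin_form g1 y + lin_form g2 y" for y
  have h_add: "h (\<lambda>i. x i + y i) = h x + h y" for x y
    by (simp add: h_def lin_form_add algebra_simps)
  have prod: "lin_form f2 y * h y = 0" for y
    using q[of y] by (simp add: h_def f1 algebra_simps)
  show thesis
  proof (cases "\<forall>y. lin_form f2 y = 0")
    case True
    obtain w where "\<exists>i\<in>{1..3}. w i \<noteq> 0" "lin_form g1 w = 0" "lin_form g2 w = 0"
      by (rule two_lin_forms_common_zero)
    with True f1 show thesis by (intro that[of w]) auto
  next
    case False
    then obtain x where x: "lin_form f2 x \<noteq> 0" by blast
    then have hx: "h x = 0" using prod[of x] by simp
    have h0: "h y = 0" for y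
    proof (rule ccontr)
      assume "h y \<noteq> 0"
      moreover from this have "lin_form f2 y = 0" using prod[of y] by simp
      ultimately show False
        using prod[of "\<lambda>i. x i + y i"] x hx by (simp add: lin_form_add h_add)
    qed
    obtain w where w: "\<exists>i\<in>{1..3}. w i \<noteq> 0" "lin_form f2 w = 0" "lin_form g1 w = 0"
      by (rule two_lin_forms_common_zero)
    with f1[of w] h0[of w] show thesis by (intro that[of w]) (auto simp: h_def)
  qed
qed

text \<open>A linear map from \<open>'k\<^sup>3\<close> into the hyperbolic space \<open>'k\<^sup>4\<close> with totally singular image is not
  injective. The identity is only required at points of \<open>'k\<^sup>3\<close>, which suffices over finite
  fields as well.\<close>

lemma hyperbolic_lin_forms_common_zero:
  fixes f1 f2 g1 g2 :: "nat \<Rightarrow> 'k::field"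
  assumes q: "\<And>x. lin_form f1 x * lin_form g1 x + lin_form f2 x * lin_form g2 x = 0"
  obtains v where "\<exists>i\<in>{1..3}. v i \<noteq> 0"
    "lin_form f1 v = 0" "lin_form f2 v = 0" "lin_form g1 v = 0" "lin_form g2 v = 0"
proof -
  obtain v where v: "\<exists>i\<in>{1..3}. v i \<noteq> 0" "lin_form f1 v = 0" "lin_form f2 v = 0"
    by (rule two_lin_forms_common_zero)
  consider "lin_form g1 v = 0" "lin_form g2 v = 0" | "lin_form g1 v \<noteq> 0" | "lin_form g2 v \<noteq> 0"
    by blast
  then show thesis
  proof cases
    case 1
    with v show ?thesis by (intro that[of v])
  next
    case 2
    show ?thesis
      by (rule hyperbolic_lin_forms_common_zero_aux[OF q v(2,3) 2]) (rule that)
  next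
    case 3
    have q': "lin_form f2 x * lin_form g2 x + lin_form f1 x * lin_form g1 x = 0" for x
      using q[of x] by (simp add: add.commute)
    show ?thesis
      by (rule hyperbolic_lin_forms_common_zero_aux[OF q' v(3,2) 3]) (rule that)
  qed
qed

section \<open>Determinants of size three\<close>

lemma det_3:
  fixes A :: "'a::comm_ring_1 mat"
  assumes A: "A \<in> carrier_mat 3 3"
  shows "det A =
      A $$ (0,0) * (A $$ (1,1) * A $$ (2,2) - A $$ (1,2) * A $$ (2,1))
    - A $$ (0,1) * (A $$ (1,0) * A $$ (2,2) - A $$ (1,2) * A $$ (2,0))
    + A $$ (0,2) * (A $$ (1,0) * A $$ (2,1) - A $$ (1,1) * A $$ (2,0))"
proof -
  have d2: "det B = B $$ (0,0) * B $$ (1,1) - B $$ (0,1) * B $$ (1,0)"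
    if B: "B \<in> carrier_mat 2 2" for B :: "'a mat"
    using that
    by (subst laplace_expansion_row[OF B, of 0])
      (simp_all add: numeral_2_eq_2 lessThan_Suc cofactor_def mat_delete_def det_single algebra_simps)
  show ?thesis
    using A
    by (subst laplace_expansion_row[OF A, of 0])
      (simp_all add: numeral_3_eq_3 lessThan_Suc cofactor_def d2[unfolded numeral_2_eq_2] mat_delete_def
        numeral_2_eq_2 algebra_simps)
qed

lemma invertible_mat_with_first_column:
  fixes \<xi> :: "'k::field vec"
  assumes \<xi>: "\<xi> \<in> carrier_vec 3" "\<xi> \<noteq> 0\<^sub>v 3"
  obtains Q where "Q \<in> carrier_mat 3 3" "det Q \<noteq> 0" "col Q 0 = \<xi>"
proof -
  define Q where "Q g = mat 3 3 (\<lambda>(i, j). if j = 0 then \<xi> $ i else if i = g j then 1 else 0)" for g :: "nat \<Rightarrow> nat"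
  have Q: "Q g \<in> carrier_mat 3 3" "col (Q g) 0 = \<xi>" for g
    using \<xi>(1) by (auto simp: Q_def)
  have "\<xi> $ 0 \<noteq> 0 \<or> \<xi> $ 1 \<noteq> 0 \<or> \<xi> $ 2 \<noteq> 0"
  proof (rule ccontr)
    assume "\<not> ?thesis"
    moreover have "i = 0 \<or> i = 1 \<or> i = 2" if "i < 3" for i :: nat using that by auto
    ultimately have "\<xi> = 0\<^sub>v 3" using \<xi>(1) by (intro eq_vecI) auto
    with \<xi>(2) show False by simp
  qed
  then consider "\<xi> $ 0 \<noteq> 0" | "\<xi> $ 1 \<noteq> 0" | "\<xi> $ 2 \<noteq> 0" by blast
  then have "\<exists>g. det (Q g) \<noteq> 0"
  proof cases
    case 1 then show ?thesis by (intro exI[of _ "\<lambda>j. j"]) (simp add: det_3[OF Q(1)], simp add: Q_def)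
  next
    case 2 then show ?thesis by (intro exI[of _ "\<lambda>j. if j = 1 then 0 else 2"]) (simp add: det_3[OF Q(1)], simp add: Q_def)
  next
    case 3 then show ?thesis by (intro exI[of _ "\<lambda>j. j - 1"]) (simp add: det_3[OF Q(1)], simp add: Q_def)
  qed
  with Q that show thesis by blast
qed

lemma singular_mat_clear_first_row_column:
  fixes A :: "'k::field mat"
  assumes A: "A \<in> carrier_mat 3 3" "det A = 0"
  obtains P Q where "P \<in> carrier_mat 3 3" "Q \<in> carrier_mat 3 3" "det P \<noteq> 0" "det Q \<noteq> 0"
    "\<And>i. i < 3 \<Longrightarrow> (P * A * Q) $$ (i, 0) = 0" "\<And>j. j < 3 \<Longrightarrow> (P * A * Q) $$ (0, j) = 0"
proof -
  have ker: "\<exists>Q. Q \<in> carrier_mat 3 3 \<and> det Q \<noteq> 0 \<and> (\<forall>i<3. (B * Q) $$ (i, 0) = 0)"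
    if B: "B \<in> carrier_mat 3 3" "det B = 0" for B :: "'k mat"
  proof -
    obtain \<xi> where \<xi>: "\<xi> \<in> carrier_vec 3" "\<xi> \<noteq> 0\<^sub>v 3" "B *\<^sub>v \<xi> = 0\<^sub>v 3"
      using B det_0_iff_vec_prod_zero_field by blast
    obtain Q where Q: "Q \<in> carrier_mat 3 3" "det Q \<noteq> 0" "col Q 0 = \<xi>"
      using invertible_mat_with_first_column \<xi>(1,2) by blast
    have "(B * Q) $$ (i, 0) = 0" if "i < 3" for i
    proof -
      have "(B * Q) $$ (i, 0) = (B *\<^sub>v \<xi>) $ i" using B Q that by simp
      then show ?thesis using \<xi> that by simp
    qed
    with Q show ?thesis by blast
  qed
  obtain Q where Q: "Q \<in> carrier_mat 3 3" "det Q \<noteq> 0" "\<forall>i<3. (A * Q) $$ (i, 0) = 0"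
    using ker[OF A] by blast
  have AT: "transpose_mat A \<in> carrier_mat 3 3" "det (transpose_mat A) = 0"
    using A by (simp_all add: det_transpose)
  obtain R where R: "R \<in> carrier_mat 3 3" "det R \<noteq> 0" "\<forall>i<3. (transpose_mat A * R) $$ (i, 0) = 0"
    using ker[OF AT] by blast
  let ?P = "transpose_mat R"
  have P: "?P \<in> carrier_mat 3 3" using R by simp
  show thesis
  proof (rule that[of ?P Q])
    show "det ?P \<noteq> 0" using R by (simp add: det_transpose)
  next
    fix i :: nat assume i: "i < 3"
    have "(?P * A * Q) $$ (i, 0) = (?P * (A * Q)) $$ (i, 0)"
      using P A(1) Q(1) by (simp add: assoc_mult_mat)
    also have "\<dots> = row ?P i \<bullet> col (A * Q) 0" using i P A Q by simp
    also have "col (A * Q) 0 = 0\<^sub>v 3" using Q A by (intro eq_vecI) auto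
    also have "row ?P i \<bullet> 0\<^sub>v 3 = 0" using P i by (simp add: row_def)
    finally show "(?P * A * Q) $$ (i, 0) = 0" .
  next
    fix j :: nat assume j: "j < 3"
    have "(?P * A) = transpose_mat (transpose_mat A * R)"
      using A R by (simp add: transpose_mult)
    then have "row (?P * A) 0 = 0\<^sub>v 3"
      using A R by (intro eq_vecI) auto
    moreover have "(?P * A * Q) $$ (0, j) = row (?P * A) 0 \<bullet> col Q j"
      using j P A Q by (intro index_mult_mat(1)) auto
    ultimately show "(?P * A * Q) $$ (0, j) = 0" using Q j by (simp add: carrier_vecI)
  qed (use P Q in auto)
qed


section \<open>Specialisation along a line\<close>

text \<open>Restriction of a polynomial to the line \<open>x = t v\<close>, keeping of all coefficient variables only
  \<open>c\<^sub>\<alpha> = s\<close>. The inner polynomial variable is \<open>t\<close>, the outer one is \<open>s\<close>.\<close>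

definition line_eval :: "(nat \<Rightarrow> 'k::field) \<Rightarrow> (nat \<Rightarrow>\<^sub>0 nat) \<Rightarrow> 'k mpoly \<Rightarrow> 'k poly poly" where
  "line_eval v \<alpha> = eval_mpoly (\<lambda>a. [:[:a:]:])
     (\<lambda>u. case u of X i \<Rightarrow> [:[:0, v i:]:] | C \<beta> \<Rightarrow> if \<beta> = \<alpha> then [:0, 1:] else 0)"

text \<open>The constant term of a polynomial, as evaluation at the origin.\<close>

definition const_coeff :: "'k::field mpoly \<Rightarrow> 'k" where
  "const_coeff = eval_mpoly (\<lambda>a. a) (\<lambda>_. 0)"

lemma field_to_ring_hom_const: "field_to_ring_hom (\<lambda>a::'k::field. [:[:a:]:])"
  by unfold_locales (simp_all add: one_pCons)

lemma field_to_ring_hom_id: "field_to_ring_hom (\<lambda>a::'k::field. a)"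
  by unfold_locales simp_all

interpretation line: comm_ring_hom "line_eval v \<alpha>" for v :: "nat \<Rightarrow> 'k::field" and \<alpha>
  unfolding line_eval_def by (rule field_to_ring_hom.comm_ring_hom_eval_mpoly[OF field_to_ring_hom_const])

interpretation const: comm_ring_hom "const_coeff :: 'k::field mpoly \<Rightarrow> 'k"
  unfolding const_coeff_def by (rule field_to_ring_hom.comm_ring_hom_eval_mpoly[OF field_to_ring_hom_id])

interpretation embed: comm_ring_hom "Poly_Mapping.single 0 :: 'k::field \<Rightarrow> 'k mpoly"
  by unfold_locales (simp_all add: single_add mult_single)

interpretation mpoly_space: vector_space "mscale :: 'k::field \<Rightarrow> 'k mpoly \<Rightarrow> 'k mpoly"
  by (rule vector_space_mscale)

lemma const_coeff_embed: "const_coeff (Poly_Mapping.single 0 a) = a"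
  by (simp add: const_coeff_def field_to_ring_hom.eval_mpoly_single[OF field_to_ring_hom_id])

lemma line_eval_embed: "line_eval v \<alpha> (Poly_Mapping.single 0 a) = [:[:a:]:]"
  by (simp add: line_eval_def field_to_ring_hom.eval_mpoly_single[OF field_to_ring_hom_const])

lemma const_coeff_generic_poly: "const_coeff (generic_poly n d) = 0"
  by (simp add: const_coeff_def field_to_ring_hom.eval_mpoly_generic_poly[OF field_to_ring_hom_id])

lemma line_eval_generic_poly:
  assumes "\<alpha> \<in> exponents n d"
  shows "line_eval v \<alpha> (generic_poly n d) = [:0, (\<Prod>i=1..n. [:0, v i:] ^ Poly_Mapping.lookup \<alpha> i):]"
proof -
  have pow: "(\<Prod>i\<in>A. [:q i:] ^ e i) = [:\<Prod>i\<in>A. q i ^ e i:]"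
    for q :: "nat \<Rightarrow> 'a poly" and e and A :: "nat set"
    by (induction A rule: infinite_finite_induct) (simp_all add: poly_const_pow one_pCons)
  have "line_eval v \<alpha> (generic_poly n d) = (\<Sum>\<beta>\<in>exponents n d.
      (if \<beta> = \<alpha> then [:0, 1:] * (\<Prod>i=1..n. [:[:0, v i:]:] ^ Poly_Mapping.lookup \<beta> i) else 0))"
    by (auto simp: line_eval_def field_to_ring_hom.eval_mpoly_generic_poly[OF field_to_ring_hom_const] intro!: sum.cong)
  also have "\<dots> = [:0, 1:] * (\<Prod>i=1..n. [:[:0, v i:]:] ^ Poly_Mapping.lookup \<alpha> i)"
    using assms by (simp add: finite_exponents)
  finally show ?thesis by (simp add: pow)
qed

text \<open>An entry restricts to \<open>(c + t a(v)) + s b(t)\<close> with \<open>c\<close> its constant term, \<open>a\<close> a linear form that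
  depends neither on \<open>v\<close> nor on \<open>\<alpha>\<close>, and \<open>b\<close> of degree at most 1.\<close>

lemma line_eval_entry:
  fixes p :: "'k::field mpoly"
  assumes "p \<in> module.span mscale (entry_monomials n d)"
  shows "\<exists>a. \<forall>v \<alpha>. \<exists>b. degree b \<le> 1 \<and>
    line_eval v \<alpha> p = [:[:const_coeff p, \<Sum>i=1..n. a i * v i:], b:]"
  using assms
proof (induction rule: mpoly_space.span_induct_alt)
  case base
  show ?case by (intro exI[of _ "\<lambda>_. 0"] allI exI[of _ 0]) simp
next
  case (step c x y)
  have eval_Var: "line_eval v \<alpha> (Var (X i)) = [:[:0, v i:]:]"
    "line_eval v \<alpha> (Var (C \<beta>)) = (if \<beta> = \<alpha> then [:0, 1:] else 0)"
    "const_coeff (Var u :: 'k mpoly) = 0" for v :: "nat \<Rightarrow> 'k" and \<alpha> \<beta> i u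
    by (simp_all add: line_eval_def const_coeff_def field_to_ring_hom.eval_mpoly_Var[OF field_to_ring_hom_const] field_to_ring_hom.eval_mpoly_Var[OF field_to_ring_hom_id])
  have monomial: "\<exists>a. \<forall>v \<alpha>. \<exists>b. degree b \<le> 1 \<and>
      line_eval v \<alpha> x = [:[:const_coeff x, \<Sum>i=1..n. a i * v i:], b:]"
    using step(1) unfolding entry_monomials_def
  proof (elim UnE CollectE exE conjE singletonE)
    assume "x = 1"
    then show ?thesis
      by (intro exI[of _ "\<lambda>_. 0"] allI exI[of _ 0]) (simp add: one_pCons)
  next
    fix i assume "x = Var (X i)" "i \<in> {1..n}"
    then show ?thesis
      by (intro exI[of _ "\<lambda>j. if j = i then 1 else 0"] allI exI[of _ 0])
        (simp add: eval_Var if_distrib[of "\<lambda>z. z * _"] cong: if_cong)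
  next
    fix \<beta> assume "x = Var (C \<beta>)"
    then show ?thesis
      by (intro exI[of _ "\<lambda>_. 0"] allI, rename_tac v \<alpha>, rule_tac x = "if \<beta> = \<alpha> then 1 else 0" in exI)
        (simp add: eval_Var)
  next
    fix \<beta> i assume "x = Var (C \<beta>) * Var (X i)"
    then show ?thesis
      by (intro exI[of _ "\<lambda>_. 0"] allI, rename_tac v \<alpha>, rule_tac x = "if \<beta> = \<alpha> then [:0, v i:] else 0" in exI)
        (simp add: eval_Var line.hom_mult const.hom_mult)
  qed
  obtain a1 where a1: "\<And>v \<alpha>. \<exists>b. degree b \<le> 1 \<and>
      line_eval v \<alpha> x = [:[:const_coeff x, \<Sum>i=1..n. a1 i * v i:], b:]"
    using monomial by blast
  obtain a2 where a2: "\<And>v \<alpha>. \<exists>b. degree b \<le> 1 \<and>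
      line_eval v \<alpha> y = [:[:const_coeff y, \<Sum>i=1..n. a2 i * v i:], b:]"
    using step(2) by blast
  show ?case
  proof (intro exI[of _ "\<lambda>i. c * a1 i + a2 i"] allI)
    fix v \<alpha>
    obtain b1 where b1: "degree b1 \<le> 1"
      "line_eval v \<alpha> x = [:[:const_coeff x, \<Sum>i=1..n. a1 i * v i:], b1:]"
      using a1[of v \<alpha>] by blast
    obtain b2 where b2: "degree b2 \<le> 1"
      "line_eval v \<alpha> y = [:[:const_coeff y, \<Sum>i=1..n. a2 i * v i:], b2:]"
      using a2[of v \<alpha>] by blast
    have "degree (smult c b1 + b2) \<le> 1"
      using b1 b2 by (intro degree_add_le order_trans[OF degree_smult_le])
    moreover have "line_eval v \<alpha> (mscale c x + y) =
        [:[:const_coeff (mscale c x + y), \<Sum>i=1..n. (c * a1 i + a2 i) * v i:], smult c b1 + b2:]"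
      using b1(2) b2(2)
      by (simp add: mscale_def line.hom_add line.hom_mult const.hom_add const.hom_mult
          line_eval_embed const_coeff_embed distrib_right sum.distrib sum_distrib_left mult.assoc)
    ultimately show "\<exists>b. degree b \<le> 1 \<and> line_eval v \<alpha> (mscale c x + y) =
        [:[:const_coeff (mscale c x + y), \<Sum>i=1..n. (c * a1 i + a2 i) * v i:], b:]"
      by blast
  qed
qed

section \<open>No representation of size three\<close>

lemma exponents_witness:
  shows "0 \<in> exponents n d"
    and "i \<in> {1..n} \<Longrightarrow> k \<le> d \<Longrightarrow> Poly_Mapping.single i k \<in> exponents n d"
  by (auto simp: exponents_def lookup_single when_def)

text \<open>The heart of the lower bound. The factor \<open>\<kappa>\<close> accounts for the determinants of the scalar
  matrices used to clear the first row and column of the constant part.\<close>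

lemma no_scaled_rep_size_3:
  fixes M :: "'k::field mpoly mat"
  assumes M: "M \<in> carrier_mat 3 3"
    and span: "\<And>i j. i < 3 \<Longrightarrow> j < 3 \<Longrightarrow> M $$ (i, j) \<in> module.span mscale (entry_monomials 3 2)"
    and row0: "\<And>j. j < 3 \<Longrightarrow> const_coeff (M $$ (0, j)) = 0"
    and col0: "\<And>i. i < 3 \<Longrightarrow> const_coeff (M $$ (i, 0)) = 0"
    and det: "det M = mscale \<kappa> (generic_poly 3 2)"
  shows "\<kappa> = 0"
proof (rule ccontr)
  assume \<kappa>: "\<kappa> \<noteq> 0"
  define c where "c i j = const_coeff (M $$ (i, j))" for i j
  have "\<exists>a. \<forall>v \<alpha>. \<exists>b. degree b \<le> 1 \<and>
      line_eval v \<alpha> (M $$ (i, j)) = [:[:c i j, lin_form a v:], b:]" if "i < 3" "j < 3" for i j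
    using line_eval_entry[OF span[OF that]] by (simp add: lin_form_def c_def)
  then obtain a where a: "\<And>i j v \<alpha>. i < 3 \<Longrightarrow> j < 3 \<Longrightarrow> \<exists>b. degree b \<le> 1 \<and>
      line_eval v \<alpha> (M $$ (i, j)) = [:[:c i j, lin_form (a i j) v:], b:]"
    by metis
  then obtain b where deg_b: "\<And>i j v \<alpha>. i < 3 \<Longrightarrow> j < 3 \<Longrightarrow> degree (b i j v \<alpha>) \<le> 1"
    and line_M: "\<And>i j v \<alpha>. i < 3 \<Longrightarrow> j < 3 \<Longrightarrow>
      line_eval v \<alpha> (M $$ (i, j)) = [:[:c i j, lin_form (a i j) v:], b i j v \<alpha>:]"
    by metis
  have c0: "c 0 0 = 0" "c 0 1 = 0" "c 0 2 = 0" "c 1 0 = 0" "c 2 0 = 0"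
    using row0 col0 by (simp_all add: c_def)
  define A where "A v i j = [:c i j, lin_form (a i j) v:]" for v i j
  define e where "e v \<alpha> i j = [:A v i j, b i j v \<alpha>:]" for v \<alpha> i j
  have line_det: "e v \<alpha> 0 0 * (e v \<alpha> 1 1 * e v \<alpha> 2 2 - e v \<alpha> 1 2 * e v \<alpha> 2 1)
      - e v \<alpha> 0 1 * (e v \<alpha> 1 0 * e v \<alpha> 2 2 - e v \<alpha> 1 2 * e v \<alpha> 2 0)
      + e v \<alpha> 0 2 * (e v \<alpha> 1 0 * e v \<alpha> 2 1 - e v \<alpha> 1 1 * e v \<alpha> 2 0)
      = [:0, smult \<kappa> (\<Prod>i=1..3. [:0, v i:] ^ Poly_Mapping.lookup \<alpha> i):]"
    if "\<alpha> \<in> exponents 3 2" for v \<alpha>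
  proof -
    have "line_eval v \<alpha> (det M) = [:0, smult \<kappa> (\<Prod>i=1..3. [:0, v i:] ^ Poly_Mapping.lookup \<alpha> i):]"
      unfolding det mscale_def line.hom_mult line_eval_embed line_eval_generic_poly[OF that]
      by simp
    then show ?thesis
      unfolding det_3[OF M] line.hom_mult line.hom_minus line.hom_add e_def A_def
      by (simp add: line_M)
  qed
  \<comment> \<open>The terms of order 0 and 1 in \<open>s\<close>;
    the latter is the trace identity, stated where only one entry of the adjugate survives.\<close>
  have order0: "A v 0 0 * (A v 1 1 * A v 2 2 - A v 1 2 * A v 2 1)
      - A v 0 1 * (A v 1 0 * A v 2 2 - A v 1 2 * A v 2 0)
      + A v 0 2 * (A v 1 0 * A v 2 1 - A v 1 1 * A v 2 0) = 0" for v
    using arg_cong[OF line_det[OF exponents_witness(1), of v], of "\<lambda>p. poly p 0"]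
    by (simp add: e_def mult_ac)
  have order1: "b 0 0 v \<alpha> * (A v 1 1 * A v 2 2 - A v 1 2 * A v 2 1)
      = smult \<kappa> (\<Prod>i=1..3. [:0, v i:] ^ Poly_Mapping.lookup \<alpha> i)"
    if \<alpha>: "\<alpha> \<in> exponents 3 2"
      and z: "A v 0 0 = 0" "A v 0 1 = 0" "A v 0 2 = 0" "A v 1 0 = 0" "A v 2 0 = 0" for v \<alpha>
    using arg_cong[OF line_det[OF \<alpha>, of v], of "\<lambda>p. coeff p 1"]
    by (simp add: e_def z[simplified] mult_ac)
  define \<delta> where "\<delta> = c 1 1 * c 2 2 - c 1 2 * c 2 1"
  have \<delta>: "\<delta> \<noteq> 0"
  proof
    assume "\<delta> = 0"
    have A0: "A (\<lambda>_. 0) i j = [:c i j:]" for i j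
      by (simp add: A_def lin_form_3)
    have "b 0 0 (\<lambda>_. 0) 0 * [:\<delta>:] = [:\<kappa>:]"
      using order1[OF exponents_witness(1), of "\<lambda>_. 0"] unfolding A0 c0
      by (simp add: \<delta>_def mult_ac)
    then show False using \<kappa> \<open>\<delta> = 0\<close> by simp
  qed
  \<comment> \<open>The coefficients of \<open>t\<close> and \<open>t\<^sup>2\<close> in the vanishing determinant of \<open>A\<close>.\<close>
  have a00: "lin_form (a 0 0) v = 0" for v
    using arg_cong[OF order0[of v], of "\<lambda>p. coeff p 1"] \<delta>
    by (simp add: A_def c0[simplified] \<delta>_def mult_ac)
  \<comment> \<open>The pair \<open>g1, g2\<close> is the adjugate of the constant \<open>2 \<times> 2\<close> block
    applied to the rest of the first column.\<close>
  define g1 where "g1 = (\<lambda>k. c 2 2 * a 1 0 k - c 1 2 * a 2 0 k)"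
  define g2 where "g2 = (\<lambda>k. c 1 1 * a 2 0 k - c 2 1 * a 1 0 k)"
  have g: "lin_form g1 v = c 2 2 * lin_form (a 1 0) v - c 1 2 * lin_form (a 2 0) v"
     "lin_form g2 v = c 1 1 * lin_form (a 2 0) v - c 2 1 * lin_form (a 1 0) v" for v
    by (simp_all add: g1_def g2_def lin_form_3 algebra_simps)
  have "lin_form (a 0 1) v * lin_form g1 v + lin_form (a 0 2) v * lin_form g2 v = 0" for v
    using arg_cong[OF order0[of v], of "\<lambda>p. coeff p 2"]
    by (simp add: A_def c0[simplified numeral_2_eq_2 One_nat_def] a00 g coeff_pCons numeral_2_eq_2 algebra_simps)
  then obtain v where v: "\<exists>i\<in>{1..3}. v i \<noteq> 0"
    "lin_form (a 0 1) v = 0" "lin_form (a 0 2) v = 0" "lin_form g1 v = 0" "lin_form g2 v = 0"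
    using hyperbolic_lin_forms_common_zero by blast
  have "\<delta> * lin_form (a 1 0) v = c 1 1 * lin_form g1 v + c 1 2 * lin_form g2 v"
    "\<delta> * lin_form (a 2 0) v = c 2 1 * lin_form g1 v + c 2 2 * lin_form g2 v"
    by (simp_all add: g \<delta>_def algebra_simps)
  with v \<delta> have "lin_form (a 1 0) v = 0" "lin_form (a 2 0) v = 0" by simp_all
  with v have z: "A v 0 0 = 0" "A v 0 1 = 0" "A v 0 2 = 0" "A v 1 0 = 0" "A v 2 0 = 0"
    by (simp_all add: A_def c0 c0[simplified] a00)
  define m where "m = A v 1 1 * A v 2 2 - A v 1 2 * A v 2 1"
  have "b 0 0 v 0 * m = [:\<kappa>:]"
    using order1[OF exponents_witness(1) z] by (simp add: m_def)
  then have "degree (b 0 0 v 0 * m) = 0" "b 0 0 v 0 \<noteq> 0" "m \<noteq> 0" using \<kappa> by auto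
  then have deg_m: "degree m = 0" by (simp add: degree_mult_eq)
  obtain i where i: "i \<in> {1..3}" "v i \<noteq> 0" using v(1) by blast
  let ?\<alpha> = "Poly_Mapping.single i 2 :: nat \<Rightarrow>\<^sub>0 nat"
  have "(\<Prod>j=1..3. [:0, v j:] ^ Poly_Mapping.lookup ?\<alpha> j) =
      (\<Prod>j=1..3. if j = i then [:0, v j:] ^ 2 else 1)"
    by (intro prod.cong) (auto simp: lookup_single when_def)
  also have "\<dots> = [:0, v i:] ^ 2" using i(1) by simp
  finally have "b 0 0 v ?\<alpha> * m = smult \<kappa> ([:0, v i:] ^ 2)"
    using order1[OF exponents_witness(2)[OF i(1)] z, of 2] by (simp add: m_def)
  then have "degree (b 0 0 v ?\<alpha> * m) = 2"
    using \<kappa> i(2) by (simp add: degree_power_eq)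
  moreover have "degree (b 0 0 v ?\<alpha> * m) \<le> 1"
    using degree_mult_le[of "b 0 0 v ?\<alpha>" m] deg_m deg_b[of 0 0 v ?\<alpha>] by simp
  ultimately show False by simp
qed

lemma no_uniform_det_rep_size_3:
  fixes M :: "'k::field mpoly mat"
  shows "\<not> uniform_det_rep 3 2 3 M"
proof
  assume "uniform_det_rep 3 2 3 M"
  then have M: "M \<in> carrier_mat 3 3" "det M = generic_poly 3 2"
    and span: "\<And>i j. i < 3 \<Longrightarrow> j < 3 \<Longrightarrow> M $$ (i, j) \<in> module.span mscale (entry_monomials 3 2)"
    by (auto simp: uniform_det_rep_def)
  let ?A = "map_mat const_coeff M"
  have A: "?A \<in> carrier_mat 3 3" "det ?A = 0"
    using M by (simp_all add: const_coeff_generic_poly)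
  obtain P Q where PQ: "P \<in> carrier_mat 3 3" "Q \<in> carrier_mat 3 3" "det P \<noteq> 0" "det Q \<noteq> 0"
    and zero: "\<And>i. i < 3 \<Longrightarrow> (P * ?A * Q) $$ (i, 0) = 0" "\<And>j. j < 3 \<Longrightarrow> (P * ?A * Q) $$ (0, j) = 0"
    using singular_mat_clear_first_row_column[OF A] by blast
  let ?e = "Poly_Mapping.single 0 :: 'k \<Rightarrow> 'k mpoly"
  define N where "N = map_mat ?e P * M * map_mat ?e Q"
  have N: "N \<in> carrier_mat 3 3" using PQ M by (simp add: N_def)
  have "map_mat const_coeff (map_mat ?e R) = R" for R
    by (intro eq_matI) (simp_all add: const_coeff_embed)
  then have const_N: "map_mat const_coeff N = P * ?A * Q"
    using PQ M unfolding N_def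
    by (simp add: const.mat_hom_mult[of _ 3 3 _ 3])
  have "N $$ (i, j) \<in> module.span mscale (entry_monomials 3 2)" if ij: "i < 3" "j < 3" for i j
  proof -
    have PM: "(map_mat ?e P * M) $$ (i, k) \<in> module.span mscale (entry_monomials 3 2)" if "k < 3" for k
      using PQ M ij that span
      by (auto simp: scalar_prod_def mscale_def[symmetric]
          intro!: mpoly_space.span_sum mpoly_space.span_scale)
    have "N $$ (i, j) = (\<Sum>k<3. mscale (Q $$ (k, j)) ((map_mat ?e P * M) $$ (i, k)))"
      using PQ M ij unfolding N_def
      by (subst index_mult_mat(1))
        (auto simp: scalar_prod_def mscale_def mult.commute lessThan_atLeast0 intro!: sum.cong)
    with PM show ?thesis by (auto intro!: mpoly_space.span_sum mpoly_space.span_scale)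
  qed
  moreover have "const_coeff (N $$ (0, j)) = 0" "const_coeff (N $$ (j, 0)) = 0" if "j < 3" for j
    using that zero[of j] N unfolding const_N[symmetric] by simp_all
  moreover have "det N = mscale (det P * det Q) (generic_poly 3 2)"
    using PQ M by (simp add: N_def det_mult[of _ 3] mscale_def embed.hom_mult mult_ac)
  ultimately have "det P * det Q = 0"
    using no_scaled_rep_size_3[OF N] by blast
  with PQ show False by simp
qed

text \<open>Padding by a diagonal entry 1 enlarges a representation, since 1 is an admissible entry.\<close>

lemma uniform_det_rep_Suc:
  fixes M :: "'k::field mpoly mat"
  assumes "uniform_det_rep n d N M"
  shows "\<exists>M' :: 'k mpoly mat. uniform_det_rep n d (Suc N) M'"
proof -
  have M: "M \<in> carrier_mat N N" "det M = generic_poly n d"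
    and span: "\<And>i j. i < N \<Longrightarrow> j < N \<Longrightarrow> M $$ (i, j) \<in> module.span mscale (entry_monomials n d)"
    using assms by (auto simp: uniform_det_rep_def)
  have one: "1 \<in> module.span mscale (entry_monomials n d :: 'k mpoly set)"
    by (rule mpoly_space.span_base) (simp add: entry_monomials_def)
  let ?M' = "four_block_mat (1\<^sub>m 1) (0\<^sub>m 1 N) (0\<^sub>m N 1) M"
  have "det ?M' = det (1\<^sub>m 1 :: 'k mpoly mat) * det M"
    using M by (intro det_four_block_mat_lower_left_zero_col) auto
  moreover have "?M' $$ (i, j) \<in> module.span mscale (entry_monomials n d)"
    if "i < Suc N" "j < Suc N" for i j
    using that M span one mpoly_space.span_zero by (cases i; cases j) auto
  ultimately have "uniform_det_rep n d (Suc N) ?M'"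
    using M by (auto simp: uniform_det_rep_def)
  then show ?thesis by blast
qed

lemma uniform_det_rep_le:
  fixes M :: "'k::field mpoly mat"
  assumes "uniform_det_rep n d N M" "N \<le> N'"
  shows "\<exists>M' :: 'k mpoly mat. uniform_det_rep n d N' M'"
  using assms(2,1) by (induction rule: dec_induct) (auto intro: uniform_det_rep_Suc)

section \<open>A representation of size four\<close>

lemma small_monomial:
  fixes x y z :: "'a::comm_monoid_mult"
  assumes "a + b + c \<le> (1::nat)"
  shows "x ^ a * y ^ b * z ^ c \<in> {1, x, y, z}"
proof -
  consider "a = 0" "b = 0" "c = 0" | "a = 1" "b = 0" "c = 0" | "a = 0" "b = 1" "c = 0" | "a = 0" "b = 0" "c = 1"
    using assms by linarith
  then show ?thesis by cases auto
qed

lemma quadratic_monomial_split: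
  fixes x y z :: "'a::comm_ring_1"
  assumes "a + b + c \<le> (2::nat)"
  shows "\<exists>h :: nat \<Rightarrow> 'a. (\<forall>j. h j \<in> {0, 1, x, y, z}) \<and>
    x ^ a * y ^ b * z ^ c = h 0 + x * h 1 + y * h 2 + z * h 3"
proof -
  consider "a \<noteq> 0" | "a = 0" "b \<noteq> 0" | "a = 0" "b = 0" "c \<noteq> 0" | "a = 0" "b = 0" "c = 0"
    by blast
  then show ?thesis
  proof cases
    case 1
    then obtain a' where "a = Suc a'" by (cases a) auto
    then show ?thesis using assms small_monomial[of a' b c x y z]
      by (intro exI[of _ "(\<lambda>_. 0)(1 := x ^ a' * y ^ b * z ^ c)"]) (auto simp: mult_ac)
  next
    case 2
    then obtain b' where "b = Suc b'" by (cases b) auto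
    then show ?thesis using 2 assms small_monomial[of a b' c x y z]
      by (intro exI[of _ "(\<lambda>_. 0)(2 := x ^ a * y ^ b' * z ^ c)"]) (auto simp: mult_ac)
  next
    case 3
    then obtain c' where "c = Suc c'" by (cases c) auto
    then show ?thesis using 3 assms small_monomial[of a b c' x y z]
      by (intro exI[of _ "(\<lambda>_. 0)(3 := x ^ a * y ^ b * z ^ c')"]) (auto simp: mult_ac)
  next
    case 4
    then show ?thesis by (intro exI[of _ "(\<lambda>_. 0)(0 := 1)"]) auto
  qed
qed

text \<open>Multiplying on the right by the identity matrix with its first column replaced by \<open>x\<close>
  clears everything below the upper left corner.\<close>

lemma det_bordered_identity:
  fixes r x :: "nat \<Rightarrow> 'a::comm_ring_1"
  assumes "x 0 = 1"
  shows "det (mat (Suc n) (Suc n) (\<lambda>(i, j). if i = 0 then r j else if j = 0 then - x i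
      else if i = j then 1 else 0)) = (\<Sum>j\<le>n. r j * x j)" (is "det ?M = _")
proof -
  let ?T = "mat (Suc n) (Suc n) (\<lambda>(i, j). if j = 0 then x i else if i = j then 1 else 0)"
  have M: "?M \<in> carrier_mat (Suc n) (Suc n)" and T: "?T \<in> carrier_mat (Suc n) (Suc n)"
    by simp_all
  have "det ?T = prod_list (diag_mat ?T)"
    by (rule det_lower_triangular[OF _ T]) auto
  also have "\<dots> = 1"
    unfolding prod_list_diag_prod using assms by (intro prod.neutral) auto
  finally have detT: "det ?T = 1" .
  have prod: "(?M * ?T) $$ (i, j) = (\<Sum>k\<le>n. ?M $$ (i, k) * ?T $$ (k, j))"
    if "i \<le> n" "j \<le> n" for i j
    using that by (auto simp: scalar_prod_def lessThan_Suc_atMost[symmetric] lessThan_atLeast0 intro!: sum.cong)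
  have first: "(?M * ?T) $$ (0, 0) = (\<Sum>j\<le>n. r j * x j)"
    by (subst prod) (auto intro!: sum.cong)
  have below: "(?M * ?T) $$ (i, j) = (if i = j then 1 else 0)" if ij: "0 < i" "i \<le> n" "j \<le> n" for i j
  proof -
    have "(?M * ?T) $$ (i, j) =
        (\<Sum>k\<le>n. (if k = 0 then - x i * (if j = 0 then 1 else 0) else 0) + (if k = i then ?T $$ (i, j) else 0))"
      using ij assms by (subst prod) (auto intro!: sum.cong)
    also have "\<dots> = (if i = j then 1 else 0)"
      using ij by (simp add: sum.distrib)
    finally show ?thesis .
  qed
  have "det (?M * ?T) = prod_list (diag_mat (?M * ?T))"
    by (rule det_upper_triangular[where n = "Suc n"]) (use below in \<open>auto simp del: index_mult_mat(1)\<close>)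
  also have "\<dots> = (?M * ?T) $$ (0, 0) * (\<Prod>i<n. (?M * ?T) $$ (Suc i, Suc i))"
    by (simp add: prod_list_diag_prod lessThan_atLeast0 prod.atLeast0_lessThan_Suc_shift
        del: index_mult_mat(1) prod.op_ivl_Suc)
  also have "(\<Prod>i<n. (?M * ?T) $$ (Suc i, Suc i)) = 1"
    by (intro prod.neutral) (use below in \<open>auto simp del: index_mult_mat(1)\<close>)
  finally have "det (?M * ?T) = (\<Sum>j\<le>n. r j * x j)"
    using first by simp
  then show ?thesis
    by (simp only: det_mult[OF M T] detT mult_1_right)
qed

lemma uniform_det_rep_size_4: "\<exists>M :: 'k::field mpoly mat. uniform_det_rep 3 2 4 M"
proof -
  let ?x = "\<lambda>i. Var (X i) :: 'k mpoly"
  let ?S = "module.span mscale (entry_monomials 3 2 :: 'k mpoly set)"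
  have three: "{1..3::nat} = {1, 2, 3}" "{Suc 0..3} = {1, 2, 3}" "{..3::nat} = {0, 1, 2, 3}" by auto
  have "\<forall>\<alpha>\<in>exponents 3 2. \<exists>h :: nat \<Rightarrow> 'k mpoly. (\<forall>j. h j \<in> {0, 1, ?x 1, ?x 2, ?x 3}) \<and>
      (\<Prod>i=1..3. ?x i ^ Poly_Mapping.lookup \<alpha> i) = h 0 + ?x 1 * h 1 + ?x 2 * h 2 + ?x 3 * h 3"
  proof
    fix \<alpha> assume "\<alpha> \<in> exponents 3 2"
    then show "\<exists>h :: nat \<Rightarrow> 'k mpoly. (\<forall>j. h j \<in> {0, 1, ?x 1, ?x 2, ?x 3}) \<and>
      (\<Prod>i=1..3. ?x i ^ Poly_Mapping.lookup \<alpha> i) = h 0 + ?x 1 * h 1 + ?x 2 * h 2 + ?x 3 * h 3"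
      using quadratic_monomial_split[of "Poly_Mapping.lookup \<alpha> 1" "Poly_Mapping.lookup \<alpha> 2"
          "Poly_Mapping.lookup \<alpha> 3" "?x 1" "?x 2" "?x 3"]
      by (simp add: exponents_def three mult.assoc add.assoc)
  qed
  from bchoice[OF this] obtain h :: "(nat \<Rightarrow>\<^sub>0 nat) \<Rightarrow> nat \<Rightarrow> 'k mpoly" where
    h: "\<And>\<alpha> j. \<alpha> \<in> exponents 3 2 \<Longrightarrow> h \<alpha> j \<in> {0, 1, ?x 1, ?x 2, ?x 3}"
    and split: "\<And>\<alpha>. \<alpha> \<in> exponents 3 2 \<Longrightarrow> (\<Prod>i=1..3. ?x i ^ Poly_Mapping.lookup \<alpha> i) =
      h \<alpha> 0 + ?x 1 * h \<alpha> 1 + ?x 2 * h \<alpha> 2 + ?x 3 * h \<alpha> 3"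
    by blast
  define r where "r j = (\<Sum>\<alpha>\<in>exponents 3 2. Var (C \<alpha>) * h \<alpha> j)" for j
  define y where "y i = (if i = 0 then 1 else ?x i)" for i
  define M where "M = mat (Suc 3) (Suc 3) (\<lambda>(i, j). if i = 0 then r j else if j = 0 then - y i
      else if i = j then 1 else 0)"
  have "Var (C \<alpha>) * h \<alpha> j \<in> ?S" if "\<alpha> \<in> exponents 3 2" for \<alpha> j
  proof (cases "h \<alpha> j = 0")
    case True
    then show ?thesis by (simp add: mpoly_space.span_zero)
  next
    case False
    have "Var (C \<alpha>) * h \<alpha> j \<in> entry_monomials 3 2"
    proof (cases "h \<alpha> j = 1")
      case True
      then show ?thesis using that unfolding entry_monomials_def by auto
    next
      case False
      with h[OF that, of j] \<open>h \<alpha> j \<noteq> 0\<close> have "\<exists>i\<in>{1, 2, 3}. h \<alpha> j = ?x i" by simp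
      then obtain i where "i \<in> {1..3}" "h \<alpha> j = ?x i" unfolding three by blast
      with that show ?thesis unfolding entry_monomials_def
        by (intro UnI2 CollectI exI[of _ \<alpha>] exI[of _ i]) simp
    qed
    then show ?thesis by (rule mpoly_space.span_base)
  qed
  then have r: "r j \<in> ?S" for j
    unfolding r_def by (intro mpoly_space.span_sum)
  have one: "1 \<in> ?S" by (rule mpoly_space.span_base) (simp add: entry_monomials_def)
  have y: "y i \<in> ?S" if "i \<le> 3" for i
    by (rule mpoly_space.span_base) (use that in \<open>auto simp: y_def entry_monomials_def\<close>)
  have "det M = (\<Sum>j\<le>3. r j * y j)"
    unfolding M_def by (rule det_bordered_identity) (simp add: y_def)
  also have "\<dots> = (\<Sum>\<alpha>\<in>exponents 3 2. Var (C \<alpha>) *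
      (h \<alpha> 0 + ?x 1 * h \<alpha> 1 + ?x 2 * h \<alpha> 2 + ?x 3 * h \<alpha> 3))"
    by (simp add: three y_def r_def sum_distrib_right sum_distrib_left sum.distrib[symmetric] algebra_simps)
  also have "\<dots> = generic_poly 3 2"
    unfolding generic_poly_def by (intro sum.cong refl) (simp only: split)
  finally have "det M = generic_poly 3 2" .
  moreover have "M $$ (i, j) \<in> ?S" if "i < 4" "j < 4" for i j
    using that r y[of i] one by (auto simp: M_def mpoly_space.span_zero mpoly_space.span_neg)
  ultimately have "uniform_det_rep 3 2 4 M"
    by (auto simp: uniform_det_rep_def M_def)
  then show ?thesis by blast
qed

theorem proposition6p2:
  shows "(\<exists>M :: 'k::field mpoly mat. uniform_det_rep 3 2 4 M) \<and> Nstar TYPE('k) 3 2 = 4"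
proof
  show ex: "\<exists>M :: 'k mpoly mat. uniform_det_rep 3 2 4 M"
    by (rule uniform_det_rep_size_4)
  show "Nstar TYPE('k) 3 2 = 4"
    unfolding Nstar_def
  proof (rule Least_equality)
    show "\<exists>M :: 'k mpoly mat. uniform_det_rep 3 2 4 M" by (rule ex)
  next
    fix N assume "\<exists>M :: 'k mpoly mat. uniform_det_rep 3 2 N M"
    then obtain M :: "'k mpoly mat" where M: "uniform_det_rep 3 2 N M" by blast
    show "4 \<le> N"
    proof (rule ccontr)
      assume "\<not> 4 \<le> N"
      then have "N \<le> 3" by simp
      from uniform_det_rep_le[OF M this] show False
        using no_uniform_det_rep_size_3 by blast
    qed
  qed
qed

end
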